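(* Let $\mathcal{G}=(V,E)$ be a hypergraph and let $c_1,\dots,c_k$ be integers with $2\leq c_1\leq \cdots\leq c_k\leq |V|$ such that $\operatorname{cr}(\mathcal{G})\geq \max\{c_k, \lceil |V|/2 \rceil+1\}$. Then $\mathcal{G}$ can be decomposed into $k$ cycles of lengths $c_1,\dots,c_k$ if and only if $\sum_{i=1}^k c_i=|E|$.
   Context: Hypergraphs are finite and may have multiple edges (copies of the same vertex subset count as distinct edges). The corank $\operatorname{cr}(\mathcal{G})$ of $\mathcal{G}=(V,E)$ is $\min\{|e|: e\in E\}$. A hypergraph with vertex set $V$ and edge set $E$ is a cycle of length $t$ (a Berge cycle, $t\geq 2$) if there is an alternating sequence $v_1,e_1,v_2,e_2,\dots,v_t,e_t$ of distinct vertices $v_i\in V$ and distinct edges $e_i$ with $E=\{e_1,\dots,e_t\}$ and $\{v_i,v_{i+1}\}\subseteq e_i$ for $1\leq i\leq t$, where $v_{t+1}:=v_1$. (The vertices $v_1,\dots,v_t$ need not be all of $V$.) A decomposition of $\mathcal{G}$ is a partition of its edge set; $\mathcal G$ is decomposed into cycles of lengths $c_1,\dots,c_k$ if $E$ is partitioned into $k$ sets, the $i$-th of which is the edge set of a cycle of length $c_i$. *)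

theory Defs
  imports Complex_Main "HOL-Library.Extended_Nat" "HOL-Library.Disjoint_Sets"
begin

text \<open>
  Edges are abstract labels and \<open>ends\<close> gives the vertex set of each of them, so distinct edges may
  be copies of the same vertex subset.
\<close>

record ('v, 'e) pre_hypergraph =
  verts :: "'v set"
  edges :: "'e set"
  ends :: "'e \<Rightarrow> 'v set"

locale hypergraph =
  fixes G :: "('v, 'e) pre_hypergraph" (structure)
  assumes finite_verts: "finite (verts G)"
    and finite_edges: "finite (edges G)"
    and ends_subset: "e \<in> edges G \<Longrightarrow> ends G e \<subseteq> verts G"

text \<open>
  The infimum is taken in \<^typ>\<open>enat\<close>, so that the minimum over an empty edge set is \<open>\<infinity>\<close>; for
  non-empty edge sets it is the ordinary minimum, see \<open>corank_eq_Min\<close> below.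
\<close>

definition corank :: "('v, 'e) pre_hypergraph \<Rightarrow> enat" where
  "corank G = (INF e\<in>edges G. enat (card (ends G e)))"

lemma (in hypergraph) corank_eq_Min:
  assumes "edges G \<noteq> {}"
  shows "corank G = enat (Min ((\<lambda>e. card (ends G e)) ` edges G))"
proof -
  let ?c = "\<lambda>e. card (ends G e)"
  have fin: "finite (?c ` edges G)" and ne: "?c ` edges G \<noteq> {}"
    using finite_edges assms by auto
  have "Min (?c ` edges G) \<in> ?c ` edges G"
    using fin ne by (rule Min_in)
  then obtain e where e: "e \<in> edges G" "?c e = Min (?c ` edges G)"
    by auto
  show ?thesis
    unfolding corank_def
  proof (rule antisym)
    show "(INF e\<in>edges G. enat (?c e)) \<le> enat (Min (?c ` edges G))"
      using e by (metis INF_lower)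
    show "enat (Min (?c ` edges G)) \<le> (INF e\<in>edges G. enat (?c e))"
      using fin by (intro INF_greatest) simp
  qed
qed

text \<open>
  Berge cycles: the sequence is \<open>v 1, e 1, \<dots>, v t, e t\<close>, and the index \<open>t + 1\<close> is read as \<open>1\<close>. The
  edges of the sequence are all the edges, but there may be further vertices.
\<close>

definition is_cycle :: "('v, 'e) pre_hypergraph \<Rightarrow> nat \<Rightarrow> bool" where
  "is_cycle H t \<longleftrightarrow> 2 \<le> t \<and>
    (\<exists>(v :: nat \<Rightarrow> 'v) (e :: nat \<Rightarrow> 'e).
      inj_on v {1..t} \<and> v ` {1..t} \<subseteq> verts H \<and>
      inj_on e {1..t} \<and> e ` {1..t} = edges H \<and>
      (\<forall>i\<in>{1..t}. {v i, v (if i = t then 1 else i + 1)} \<subseteq> ends H (e i)))"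

text \<open>
  The parts \<open>P 1, \<dots>, P k\<close> need no explicit non-emptiness condition, because cycles have edges.
\<close>

definition decomposes_into_cycles ::
    "('v, 'e) pre_hypergraph \<Rightarrow> nat \<Rightarrow> (nat \<Rightarrow> nat) \<Rightarrow> bool" where
  "decomposes_into_cycles G k c \<longleftrightarrow>
    (\<exists>P :: nat \<Rightarrow> 'e set.
      disjoint_family_on P {1..k} \<and> (\<Union>i\<in>{1..k}. P i) = edges G \<and>
      (\<forall>i\<in>{1..k}. is_cycle (G\<lparr>edges := P i\<rparr>) (c i)))"

end

theory Submission
  imports Defs
begin

text \<open>
  Any \<open>t\<close> edges of size at least \<open>d\<close>, where \<open>2 \<le> t \<le> d\<close> and \<open>n + 2 \<le> 2 d\<close> for the number \<open>n\<close> of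
  vertices, form a Berge cycle (this is Jackson's theorem on cycles in bipartite graphs), so every
  partition of the edge set into parts of sizes \<open>c 1, \<dots>, c k\<close> is a decomposition into cycles. Let
  a cycle \<open>C\<close> pass through all of the edges but \<open>x\<close>, put \<open>s = t - 1\<close>, and suppose that \<open>x\<close> cannot
  be added. If \<open>x\<close> misses \<open>C\<close>, then every other edge contains two vertices of \<open>x\<close>, and \<open>x\<close> fits
  between two consecutive edges, in place of the vertex that joins them. If \<open>x\<close> contains
  \<open>q > 0\<close> vertices of \<open>C\<close>, consider \<open>x\<close> and the \<open>q\<close> edges that follow these vertices on \<open>C\<close>: if two of them had a common vertex outside \<open>C\<close>, then
  \<open>C\<close> could be rerouted through it. Hence they are disjoint outside \<open>C\<close>, where \<open>x\<close> has at least
  \<open>d - q\<close> vertices and each of the others at least \<open>d - s\<close>. This makes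
  \<open>(d - q) + q (d - s) > 2 d - 2 - s\<close> vertices outside \<open>C\<close>, which is too many.
\<close>

section \<open>Berge paths\<close>

text \<open>Only the sets of edges and of joining vertices are recorded, not their order, so that
  joining and reversing paths require mere disjointness conditions. The edges may contain vertices
  outside \<open>V\<close>.\<close>

inductive berge_path :: "('e \<Rightarrow> 'v set) \<Rightarrow> 'v \<Rightarrow> 'e set \<Rightarrow> 'v set \<Rightarrow> 'v \<Rightarrow> bool"
  for f where
    single: "berge_path f a {} {a} a"
  | extend: "berge_path f a E V b \<Longrightarrow> e \<notin> E \<Longrightarrow> c \<notin> V \<Longrightarrow> c \<in> f e \<Longrightarrow> a \<in> f e
      \<Longrightarrow> berge_path f c (insert e E) (insert c V) b"

lemma berge_path_join:
  assumes "berge_path f a E V b" "berge_path f c F W d"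
    and "E \<inter> F = {}" "V \<inter> W = {}" "x \<notin> E" "x \<notin> F" "b \<in> f x" "c \<in> f x"
  shows "berge_path f a (insert x (E \<union> F)) (V \<union> W) d"
  using assms
proof (induction rule: berge_path.induct)
  case (single a)
  then show ?case using berge_path.extend[of f c F W d x a] by auto
next
  case (extend a E V b e c')
  then have "berge_path f a (insert x (E \<union> F)) (V \<union> W) d" by auto
  then have "berge_path f c' (insert e (insert x (E \<union> F))) (insert c' (V \<union> W)) d"
    using extend by (intro berge_path.extend[of f a _ _ d]) auto
  then show ?case by (simp add: insert_commute)
qed

text \<open>The first vertex moves to the far end: the reversed rest is joined through
  \<open>e\<close> to the one-vertex path at \<open>c\<close>.\<close>

lemma berge_path_sym: "berge_path f a E V b \<Longrightarrow> berge_path f b E V a"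
proof (induction rule: berge_path.induct)
  case (single a)
  show ?case by (rule berge_path.single)
next
  case (extend a E V b e c)
  then show ?case
    using berge_path_join[OF extend.IH berge_path.single[of f c], of e] by simp
qed

lemma berge_path_functions:
  assumes "berge_path f a E V b"
  obtains v e n where "inj_on v {..n}" "v ` {..n} = V" "inj_on e {..<n}" "e ` {..<n} = E"
    "v 0 = a" "v n = b" "\<And>i. i < n \<Longrightarrow> v i \<in> f (e i)" "\<And>i. i < n \<Longrightarrow> v (Suc i) \<in> f (e i)"
proof -
  have "\<exists>v e n. inj_on v {..n} \<and> v ` {..n} = V \<and> inj_on e {..<n} \<and> e ` {..<n} = E
    \<and> v 0 = a \<and> v n = b \<and> (\<forall>i<n. v i \<in> f (e i) \<and> v (Suc i) \<in> f (e i))"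
    using assms
  proof (induction rule: berge_path.induct)
    case (single a)
    show ?case by (rule exI[of _ "\<lambda>_. a"], rule exI, rule exI[of _ 0]) auto
  next
    case (extend a E V b e0 c)
    then obtain v e n where *: "inj_on v {..n}" "v ` {..n} = V" "inj_on e {..<n}" "e ` {..<n} = E"
      "v 0 = a" "v n = b" "\<forall>i<n. v i \<in> f (e i) \<and> v (Suc i) \<in> f (e i)" by blast
    have img: "(case_nat c v) ` {..Suc n} = insert c V" "(case_nat e0 e) ` {..<Suc n} = insert e0 E"
      using * by (auto simp: atMost_Suc_eq_insert_0 lessThan_Suc_eq_insert_0 image_image)
    have "inj_on (case_nat c v) {..Suc n}" "inj_on (case_nat e0 e) {..<Suc n}"
      using * extend by (auto simp: inj_on_def split: nat.splits)
    moreover have "\<forall>i<Suc n. case_nat c v i \<in> f (case_nat e0 e i)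
        \<and> case_nat c v (Suc i) \<in> f (case_nat e0 e i)"
      using * extend by (auto split: nat.splits)
    ultimately show ?case
      using img *(6)
      by (intro exI[of _ "case_nat c v"] exI[of _ "case_nat e0 e"] exI[of _ "Suc n"]) simp
  qed
  then show ?thesis using that by blast
qed

section \<open>Berge cycles and their enumerations\<close>

text \<open>A path closed up by one further edge. Distinct ends force \<open>F\<close> to be
  non-empty, hence at least two edges.\<close>

definition berge_cycle :: "('e \<Rightarrow> 'v set) \<Rightarrow> 'e set \<Rightarrow> bool" where
  "berge_cycle f E \<longleftrightarrow>
    (\<exists>a b F V e. berge_path f a F V b \<and> a \<noteq> b \<and> e \<notin> F \<and> E = insert e F \<and> a \<in> f e \<and> b \<in> f e)"

lemma berge_cycleI:
  assumes "berge_path f a F V b" "a \<noteq> b" "e \<notin> F" "a \<in> f e" "b \<in> f e" "E = insert e F"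
  shows "berge_cycle f E"
  using assms unfolding berge_cycle_def by blast

lemma berge_cycle_functions:
  assumes "berge_cycle f E"
  obtains v e where "inj_on v {..<card E}" "inj_on e {..<card E}" "e ` {..<card E} = E"
    "\<And>i. i < card E \<Longrightarrow> v i \<in> f (e i)"
    "\<And>i. i < card E \<Longrightarrow> v (Suc i mod card E) \<in> f (e i)" "2 \<le> card E"
proof -
  obtain a b F V x where p: "berge_path f a F V b"
    and x: "a \<noteq> b" "x \<notin> F" "E = insert x F" "a \<in> f x" "b \<in> f x"
    using assms unfolding berge_cycle_def by blast
  obtain v e n where *: "inj_on v {..n}" "v ` {..n} = V" "inj_on e {..<n}" "e ` {..<n} = F"
    "v 0 = a" "v n = b" "\<And>i. i < n \<Longrightarrow> v i \<in> f (e i)" "\<And>i. i < n \<Longrightarrow> v (Suc i) \<in> f (e i)"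
    using berge_path_functions[OF p] by metis
  have "card F = n" "finite F"
    using card_image[OF *(3)] unfolding *(4)[symmetric] by auto
  then have cE: "card E = Suc n"
    using x by simp
  have n: "n \<noteq> 0"
    using *(5,6) x(1) by metis
  \<comment> \<open>The closing edge gets the last index \<open>n\<close>, where
    \<open>Suc i mod Suc n\<close> returns to 0.\<close>
  let ?e = "e(n := x)"
  have img: "?e ` {..<Suc n} = E"
    using * x by (auto simp: lessThan_Suc)
  have inj: "inj_on ?e {..<Suc n}"
    using img cE by (intro eq_card_imp_inj_on) auto
  have 1: "v i \<in> f (?e i)" if "i < Suc n" for i
    using that * x by (cases "i = n") auto
  have 2: "v (Suc i mod Suc n) \<in> f (?e i)" if "i < Suc n" for i
    using that * x by (cases "i = n") auto
  show ?thesis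
    using that[of v ?e] *(1) inj img 1 2 n unfolding cE lessThan_Suc_atMost by auto
qed

lemma is_cycle_if_berge_cycle:
  assumes "berge_cycle f E" "\<And>e. e \<in> E \<Longrightarrow> f e \<subseteq> verts H" "edges H = E" "ends H = f"
  shows "is_cycle H (card E)"
proof -
  obtain v e where *: "inj_on v {..<card E}" "inj_on e {..<card E}" "e ` {..<card E} = E"
    "\<And>i. i < card E \<Longrightarrow> v i \<in> f (e i)"
    "\<And>i. i < card E \<Longrightarrow> v (Suc i mod card E) \<in> f (e i)" "2 \<le> card E"
    using berge_cycle_functions[OF assms(1)] by blast
  let ?t = "card E"
  \<comment> \<open>\<open>is_cycle\<close> counts from 1 instead of 0; at \<open>i = ?t\<close> the
    index \<open>Suc (i - 1) mod ?t\<close> is 0, which corresponds to 1 there.\<close>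
  let ?v = "\<lambda>i. v (i - 1)" and ?e = "\<lambda>i. e (i - 1)"
  have pred: "(\<lambda>i. i - 1) ` {1..?t} = {..<?t}"
    unfolding image_Suc_lessThan[symmetric] image_image by simp
  have predinj: "inj_on (\<lambda>i. i - 1) {1..?t}"
    by (auto simp: inj_on_def)
  have "inj_on ?v {1..?t}" "inj_on ?e {1..?t}"
    using comp_inj_on[OF predinj, of v] comp_inj_on[OF predinj, of e] *(1,2)
    unfolding pred comp_def by auto
  moreover have "?e ` {1..?t} = E"
    using *(3) image_image[of e "\<lambda>i. i - 1" "{1..?t}"] unfolding pred by simp
  moreover have "?v ` {1..?t} = v ` {..<?t}"
    using image_image[of v "\<lambda>i. i - 1" "{1..?t}"] unfolding pred by simp
  moreover have "v ` {..<?t} \<subseteq> verts H"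
    using *(3,4) assms(2) by blast
  moreover have "{?v i, ?v (if i = ?t then 1 else i + 1)} \<subseteq> f (?e i)" if "i \<in> {1..?t}" for i
    using that *(4,5)[of "i - 1"] by (cases "i = ?t") auto
  ultimately show ?thesis
    unfolding is_cycle_def assms(3,4) using *(6)
    by (intro conjI exI[of _ ?v] exI[of _ ?e] ballI) simp_all
qed

section \<open>Periodically indexed cycles and the insertion of an edge\<close>

text \<open>Indices are read modulo \<open>s\<close> through periodicity, so that arcs may wrap around.\<close>

locale periodic_cycle =
  fixes f :: "'e \<Rightarrow> 'v set" and s :: nat and v :: "nat \<Rightarrow> 'v" and e :: "nat \<Rightarrow> 'e"
  assumes v_eq_iff: "v i = v j \<longleftrightarrow> i mod s = j mod s"
    and e_eq_iff: "e i = e j \<longleftrightarrow> i mod s = j mod s"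
    and v_in: "v i \<in> f (e i)" and v_Suc_in: "v (Suc i) \<in> f (e i)"
    and s_ge_2: "2 \<le> s"
begin

lemma mod_window_eq:
  assumes "a \<le> i" "a \<le> j" "i < a + s" "j < a + s" "i mod s = j mod s"
  shows "i = j"
proof -
  have *: "i = j" if "i \<le> j" "a \<le> i" "j < a + s" "i mod s = j mod s" for i j
  proof -
    have "s dvd j - i" using that by (metis mod_eq_dvd_iff_nat)
    moreover have "j - i < s" using that by linarith
    ultimately show ?thesis using that(1) by (metis diff_is_0_eq le_antisym dvd_imp_le not_le neq0_conv)
  qed
  show ?thesis using assms *[of i j] *[of j i] by (cases "i \<le> j") auto
qed

lemma v_inj_window: "inj_on v {a..<a + s}"
  using mod_window_eq by (auto intro!: inj_onI simp: v_eq_iff)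

lemma e_inj_window: "inj_on e {a..<a + s}"
  using mod_window_eq by (auto intro!: inj_onI simp: e_eq_iff)

lemma v_shift: "v (i + s) = v i" by (simp add: v_eq_iff)

text \<open>By counting: the range has at most \<open>s\<close> elements, and a window of length
  \<open>s\<close> supplies \<open>s\<close> distinct ones. A cycle can thus be cut open at any
  index.\<close>

lemma range_e_window: "range e = e ` {a..<a + s}"
proof -
  have sub: "range e \<subseteq> e ` {..<s}"
  proof
    fix y assume "y \<in> range e"
    then obtain i where "y = e (i mod s)" by (auto simp: e_eq_iff)
    then show "y \<in> e ` {..<s}" using s_ge_2 by auto
  qed
  have "card (range e) \<le> s"
    using card_mono[OF _ sub] card_image_le[of "{..<s}" e] by simp
  also have "s = card (e ` {a..<a + s})"
    by (simp add: card_image e_inj_window)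
  finally show ?thesis
    using finite_subset[OF sub] by (intro card_seteq[symmetric]) auto
qed

lemma range_v_window: "range v = v ` {..<s}"
proof -
  have "v i \<in> v ` {..<s}" for i
    using s_ge_2 v_eq_iff[of i "i mod s"] by auto
  then show ?thesis by auto
qed

text \<open>The bound on \<open>b\<close> keeps the arc inside one window, where \<open>v\<close>
  and \<open>e\<close> are injective; \<open>b\<close> may exceed \<open>s\<close>, so that the arc
  wraps around.\<close>

lemma arc: "a \<le> b \<Longrightarrow> b < a + s \<Longrightarrow> berge_path f (v a) (e ` {a..<b}) (v ` {a..b}) (v b)"
proof (induction "b - a" arbitrary: a)
  case 0
  then show ?case by (auto intro: berge_path.single)
next
  case (Suc n)
  then have IH: "berge_path f (v (Suc a)) (e ` {Suc a..<b}) (v ` {Suc a..b}) (v b)" by auto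
  have "e a \<notin> e ` {Suc a..<b}"
    using Suc.prems by (subst inj_on_image_mem_iff[OF e_inj_window[of a]]) auto
  moreover have "v a \<notin> v ` {Suc a..b}"
    using Suc.prems by (subst inj_on_image_mem_iff[OF v_inj_window[of a]]) auto
  ultimately have "berge_path f (v a) (insert (e a) (e ` {Suc a..<b})) (insert (v a) (v ` {Suc a..b})) (v b)"
    by (intro berge_path.extend[OF IH]) (auto simp: v_in v_Suc_in)
  moreover have "{a..<b} = insert a {Suc a..<b}" "{a..b} = insert a {Suc a..b}"
    using Suc by auto
  ultimately show ?case by simp
qed

text \<open>The step \<open>v i\<close>, \<open>e i\<close>, \<open>v (Suc i)\<close> is replaced by
  the detour \<open>v i\<close>, \<open>x\<close>, \<open>y\<close>, \<open>e i\<close>,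
  \<open>v (Suc i)\<close>.\<close>

lemma insert_edge:
  assumes "x \<notin> range e" "y \<notin> range v" "v i \<in> f x" "y \<in> f x" "y \<in> f (e i)"
  shows "berge_cycle f (insert x (range e))"
proof -
  have p: "berge_path f (v (Suc i)) (e ` {Suc i..<i + s}) (v ` {Suc i..i + s}) (v (i + s))"
    using s_ge_2 by (intro arc) auto
  have ei: "e i \<notin> e ` {Suc i..<i + s}"
    using s_ge_2 by (subst inj_on_image_mem_iff[OF e_inj_window[of i]]) auto
  have q: "berge_path f y (insert (e i) (e ` {Suc i..<i + s})) (insert y (v ` {Suc i..i + s})) (v (i + s))"
    using assms ei by (intro berge_path.extend[OF p]) (auto simp: v_Suc_in)
  have "{i..<i + s} = insert i {Suc i..<i + s}"
    using s_ge_2 by auto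
  then have "range e = insert (e i) (e ` {Suc i..<i + s})"
    unfolding range_e_window[of i] by simp
  then show ?thesis
    using assms by (intro berge_cycleI[OF q, of x]) (auto simp: v_shift)
qed

text \<open>The new cycle runs \<open>w\<close>, \<open>e i\<close>, \<open>v (Suc i)\<close>,
  forward to \<open>v j\<close>, then \<open>x\<close>, \<open>v i\<close>, backward to
  \<open>v (Suc j)\<close>, and through \<open>e j\<close> back to \<open>w\<close>. The backward
  part is the reversal of the arc from \<open>Suc j\<close> to \<open>i + s\<close>.\<close>

lemma reroute:
  assumes "x \<notin> range e" "w \<notin> range v" "i < j" "j < s"
    and "v i \<in> f x" "v j \<in> f x" "w \<in> f (e i)" "w \<in> f (e j)"
  shows "berge_cycle f (insert x (range e))"
proof -
  let ?E = "e ` {Suc i..<j}" and ?F = "e ` {Suc j..<i + s}"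
  let ?V = "v ` {Suc i..j}" and ?W = "v ` {Suc j..i + s}"
  have p: "berge_path f (v (Suc i)) ?E ?V (v j)" using assms by (intro arc) auto
  have "berge_path f (v (Suc j)) ?F ?W (v (i + s))" using assms by (intro arc) auto
  then have q: "berge_path f (v i) ?F ?W (v (Suc j))" using berge_path_sym by (simp add: v_shift)
  have "?E \<inter> ?F = {}"
    using assms by (subst inj_on_image_Int[OF e_inj_window[of "Suc i"], symmetric]) auto
  moreover have "?V \<inter> ?W = {}"
    using assms by (subst inj_on_image_Int[OF v_inj_window[of "Suc i"], symmetric]) auto
  ultimately have pq: "berge_path f (v (Suc i)) (insert x (?E \<union> ?F)) (?V \<union> ?W) (v (Suc j))"
    using assms by (intro berge_path_join[OF p q]) auto
  have "e i \<notin> e ` ({Suc i..<j} \<union> {Suc j..<i + s})"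
    using assms by (subst inj_on_image_mem_iff[OF e_inj_window[of i]]) auto
  then have ei: "e i \<notin> insert x (?E \<union> ?F)"
    using assms(1) unfolding image_Un by auto
  have w: "berge_path f w (insert (e i) (insert x (?E \<union> ?F))) (insert w (?V \<union> ?W)) (v (Suc j))"
    using assms ei by (intro berge_path.extend[OF pq]) (auto simp: v_Suc_in)
  have "e j \<notin> e ` insert i ({Suc i..<j} \<union> {Suc j..<i + s})"
    using assms by (subst inj_on_image_mem_iff[OF e_inj_window[of i]]) auto
  then have ej: "e j \<notin> insert (e i) (insert x (?E \<union> ?F))"
    using assms(1) unfolding image_insert image_Un by auto
  have "{i..<i + s} = insert j (insert i ({Suc i..<j} \<union> {Suc j..<i + s}))"
    using assms by auto
  then have "range e = insert (e j) (insert (e i) (?E \<union> ?F))"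
    unfolding range_e_window[of i] by (simp add: image_Un)
  then show ?thesis
    using assms ej by (intro berge_cycleI[OF w, of "e j"]) (auto simp: v_Suc_in)
qed

text \<open>The vertex \<open>v 1\<close> is given up: \<open>v 0\<close>, \<open>e 0\<close>,
  \<open>v 1\<close>, \<open>e 1\<close>, \<open>v 2\<close> becomes \<open>v 0\<close>,
  \<open>e 0\<close>, \<open>y\<close>, \<open>x\<close>, \<open>z\<close>, \<open>e 1\<close>,
  \<open>v 2\<close>. For \<open>s = 2\<close> the vertices \<open>v 2\<close> and
  \<open>v 0\<close> coincide and the remaining arc is a single vertex.\<close>

lemma insert_edge_off_cycle:
  assumes "x \<notin> range e" "y \<notin> range v" "z \<notin> range v" "y \<noteq> z"
    and "y \<in> f x" "z \<in> f x" "y \<in> f (e 0)" "z \<in> f (e 1)"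
  shows "berge_cycle f (insert x (range e))"
proof -
  have p: "berge_path f (v 2) (e ` {2..<s}) (v ` {2..s}) (v s)"
    using s_ge_2 by (intro arc) auto
  have e1: "e 1 \<notin> e ` {2..<s}"
    using s_ge_2 by (subst inj_on_image_mem_iff[OF e_inj_window[of 0]]) auto
  have q: "berge_path f z (insert (e 1) (e ` {2..<s})) (insert z (v ` {2..s})) (v s)"
    using assms e1 v_Suc_in[of 1] by (intro berge_path.extend[OF p]) (auto simp: numeral_2_eq_2)
  have r: "berge_path f y (insert x (insert (e 1) (e ` {2..<s})))
      (insert y (insert z (v ` {2..s}))) (v s)"
    using assms by (intro berge_path.extend[OF q]) auto
  have "e 0 \<notin> e ` insert 1 {2..<s}"
    using s_ge_2 by (subst inj_on_image_mem_iff[OF e_inj_window[of 0]]) auto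
  then have e0: "e 0 \<notin> insert x (insert (e 1) (e ` {2..<s}))"
    using assms(1) unfolding image_insert by auto
  have "{0..<0 + s} = insert 0 (insert 1 {2..<s})"
    using s_ge_2 by auto
  then have "range e = insert (e 0) (insert (e 1) (e ` {2..<s}))"
    unfolding range_e_window[of 0] by simp
  then show ?thesis
    using assms e0 v_in[of 0] v_shift[of 0] by (intro berge_cycleI[OF r, of "e 0"]) auto
qed

lemma extend_cycle:
  assumes "finite V" "card V + 2 \<le> 2 * d" "s < d" "x \<notin> range e"
    and sub: "\<And>y. y \<in> insert x (range e) \<Longrightarrow> f y \<subseteq> V"
    and size: "\<And>y. y \<in> insert x (range e) \<Longrightarrow> d \<le> card (f y)"
  shows "berge_cycle f (insert x (range e))"
proof (rule ccontr)
  assume no: "\<not> berge_cycle f (insert x (range e))"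
  let ?C = "range v"
  \<comment> \<open>\<open>card S\<close> is the number q of vertices of \<open>x\<close> on the
    cycle; \<open>N\<close> and \<open>out i\<close> are the parts off the cycle of \<open>x\<close>
    and of the edge following \<open>v i\<close>.\<close>
  define S where "S = {i. i < s \<and> v i \<in> f x}"
  define N where "N = f x - ?C"
  define out where "out i = f (e i) - ?C" for i
  have C: "?C = v ` {..<s}"
    by (rule range_v_window)
  have inj: "inj_on v {..<s}"
    using v_inj_window[of 0] by (simp add: lessThan_atLeast0)
  have cC: "card ?C = s" and fC: "finite ?C"
    unfolding C using inj by (auto simp: card_image)
  have "v i \<in> V" for i using v_in[of i] sub[of "e i"] by auto
  then have CV: "?C \<subseteq> V" by blast
  have fin: "finite (f y)" if "y \<in> insert x (range e)" for y
    using finite_subset[OF sub[OF that] assms(1)] .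
  have finN: "finite N" and finout: "finite (out i)" for i
    using fin unfolding N_def out_def by simp_all
  have finS: "finite S" unfolding S_def by simp
  have "f x = N \<union> v ` S"
    unfolding N_def S_def C by auto
  moreover have "card (v ` S) = card S"
    using inj by (intro card_image) (auto simp: S_def inj_on_def)
  ultimately have pq: "d \<le> card N + card S"
    using size[of x] card_Un_le[of N "v ` S"] by simp
  have out: "d - s \<le> card (out i)" for i
    using size[of "e i"] diff_card_le_card_Diff[OF fC, of "f (e i)"] cC unfolding out_def by simp
  have cO: "card (V - ?C) = card V - s"
    using CV fC cC by (simp add: card_Diff_subset)
  have NV: "N \<subseteq> V - ?C" and outV: "out i \<subseteq> V - ?C" for i
    using sub[of x] sub[of "e i"] unfolding N_def out_def by auto
  show False
  proof (cases "S = {}")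
    case True
    \<comment> \<open>Here \<open>N\<close> has at least \<open>d\<close> elements and
      \<open>out i\<close> at least \<open>d - s\<close>, inside a set of
      \<open>card V - s \<le> 2 * d - s - 2\<close> elements, so they share at least two.
      \<open>s \<le> card V\<close> makes the subtraction exact.\<close>
    have two: "2 \<le> card (out i \<inter> N)" for i
    proof -
      have "card (out i \<union> N) \<le> card V - s"
        unfolding cO[symmetric] using NV outV[of i] assms(1) by (intro card_mono) simp_all
      moreover have "card (out i \<union> N) + card (out i \<inter> N) = card (out i) + card N"
        using card_Un_Int[OF finout finN] by simp
      moreover have "s \<le> card V" using card_mono[OF assms(1) CV] cC by simp
      ultimately show ?thesis
        using pq out[of i] True assms(2,3) by simp
    qed
    have "out 0 \<inter> N \<noteq> {}" using two[of 0] by auto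
    then obtain y where y: "y \<in> out 0 \<inter> N" by blast
    \<comment> \<open>Any common vertex serves \<open>e 0\<close>, but \<open>e 1\<close> needs a
      second one to avoid \<open>y\<close>.\<close>
    have "out 1 \<inter> N \<noteq> {} \<and> \<not> out 1 \<inter> N \<subseteq> {y}"
      using two[of 1] card_mono[of "{y}" "out 1 \<inter> N"] by auto
    then obtain z where "z \<in> out 1 \<inter> N" "z \<noteq> y" by blast
    then show False
      using insert_edge_off_cycle[OF assms(4), of y z] no y unfolding out_def N_def by simp
  next
    case False
    \<comment> \<open>A common vertex off the cycle would contradict \<open>no\<close>: by
      \<open>insert_edge\<close> for \<open>x\<close> and one following edge, by
      \<open>reroute\<close> for two following edges.\<close>
    have NO: "N \<inter> out i = {}" if "i \<in> S" for i
    proof -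
      have False if "y \<in> N" "y \<in> out i" for y
        using insert_edge[OF assms(4), of y i] no \<open>i \<in> S\<close> that
        unfolding N_def S_def out_def by simp
      then show ?thesis by blast
    qed
    have less: "out i \<inter> out j = {}" if "i \<in> S" "j \<in> S" "i < j" for i j
    proof -
      have False if "w \<in> out i" "w \<in> out j" for w
        using reroute[OF assms(4), of w i j] no \<open>i \<in> S\<close> \<open>j \<in> S\<close> \<open>i < j\<close> that
        unfolding S_def out_def by simp
      then show ?thesis by blast
    qed
    have OO: "out i \<inter> out j = {}" if "i \<in> S" "j \<in> S" "i \<noteq> j" for i j
      using that less[of i j] less[of j i] by (cases "i < j") (simp_all add: Int_commute)
    have "N \<union> (\<Union>i\<in>S. out i) \<subseteq> V - ?C"
      using NV outV by blast
    then have "card (N \<union> (\<Union>i\<in>S. out i)) \<le> card V - s"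
      unfolding cO[symmetric] using assms(1) by (intro card_mono) simp_all
    moreover have "card (N \<union> (\<Union>i\<in>S. out i)) = card N + (\<Sum>i\<in>S. card (out i))"
    proof -
      have "card (\<Union>i\<in>S. out i) = (\<Sum>i\<in>S. card (out i))"
        using OO finout finS by (intro card_UN_disjoint) simp_all
      moreover have "N \<inter> (\<Union>i\<in>S. out i) = {}"
        using NO by blast
      ultimately show ?thesis
        using finN finout finS by (simp add: card_Un_disjoint)
    qed
    moreover have "card S * (d - s) \<le> (\<Sum>i\<in>S. card (out i))"
      using sum_bounded_below[of S "d - s" "\<lambda>i. card (out i)"] out by simp
    ultimately have le: "card N + card S * (d - s) \<le> card V - s" by linarith
    \<comment> \<open>Since \<open>card S \<ge> 1\<close>, the product
      \<open>card S * (d - s)\<close> is at least \<open>card S + m\<close>. With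
      \<open>card N + card S \<ge> d\<close> the left side of \<open>le\<close> is then at least
      \<open>2 * d - s - 1\<close>, against \<open>card V \<le> 2 * d - 2\<close>.\<close>
    define m where "m = d - s - 1"
    have m: "d - s = Suc m" using assms(3) unfolding m_def by simp
    have "m \<le> card S * m" using False finS by (simp add: Suc_le_eq card_gt_0_iff)
    moreover have "card S * (d - s) = card S + card S * m" unfolding m by simp
    ultimately show False
      using le pq m assms(2,3) by linarith
  qed
qed

end

section \<open>Any few large edges form a cycle\<close>

lemma periodic_cycle_if_berge_cycle:
  assumes "berge_cycle f E"
  obtains v e where "periodic_cycle f (card E) v e" "range e = E"
proof -
  let ?s = "card E"
  obtain v e where *: "inj_on v {..<?s}" "inj_on e {..<?s}" "e ` {..<?s} = E"
    "\<And>i. i < ?s \<Longrightarrow> v i \<in> f (e i)"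
    "\<And>i. i < ?s \<Longrightarrow> v (Suc i mod ?s) \<in> f (e i)" "2 \<le> ?s"
    using berge_cycle_functions[OF assms] by blast
  have lt: "i mod ?s < ?s" for i using *(6) by simp
  have "periodic_cycle f ?s (\<lambda>i. v (i mod ?s)) (\<lambda>i. e (i mod ?s))"
  proof
    fix i j
    show "v (i mod ?s) = v (j mod ?s) \<longleftrightarrow> i mod ?s = j mod ?s"
      "e (i mod ?s) = e (j mod ?s) \<longleftrightarrow> i mod ?s = j mod ?s"
      using *(1,2) lt by (auto simp: inj_on_eq_iff)
    show "v (i mod ?s) \<in> f (e (i mod ?s))" "v (Suc i mod ?s) \<in> f (e (i mod ?s))"
      using *(4)[OF lt] *(5)[OF lt, of i] by (auto simp: mod_Suc_eq)
  qed (rule *(6))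
  moreover have "range (\<lambda>i. e (i mod ?s)) = E"
  proof -
    have "range (\<lambda>i. i mod ?s) = {..<?s}"
      using lt by (auto simp: image_iff) (metis mod_less)
    then show ?thesis using *(3) by (metis image_image)
  qed
  ultimately show ?thesis using that by blast
qed

text \<open>Induction on the number of edges: all edges but one form a cycle, and
  \<open>extend_cycle\<close> puts the last one back. Its requirement \<open>s < d\<close> holds
  because \<open>s = card E - 1\<close> and \<open>card E \<le> d\<close>.\<close>

theorem jackson_berge_cycle:
  assumes "finite V" "card V + 2 \<le> 2 * d" "2 \<le> card E" "card E \<le> d"
    and "\<And>e. e \<in> E \<Longrightarrow> f e \<subseteq> V" "\<And>e. e \<in> E \<Longrightarrow> d \<le> card (f e)"
  shows "berge_cycle f E"
  using assms(3-6)
proof (induction "card E" arbitrary: E rule: less_induct)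
  case (less E)
  have finE: "finite E" using less.prems(1) by (intro card_ge_0_finite) simp
  show ?case
  proof (cases "card E = 2")
    case True
    then obtain e e' where E: "E = {e, e'}" "e \<noteq> e'"
      by (metis card_2_iff)
    have fin: "finite (f e)" "finite (f e')"
      using finite_subset[OF less.prems(3) assms(1)] E(1) by simp_all
    have "card (f e \<union> f e') \<le> card V"
      using less.prems(3)[of e] less.prems(3)[of e'] E(1) assms(1) by (intro card_mono) simp_all
    \<comment> \<open>Two sets of size at least \<open>d\<close> in \<open>V\<close> share at least
      \<open>2 * d - card V \<ge> 2\<close> vertices, enough for a cycle of length 2.\<close>
    then have 2: "2 \<le> card (f e \<inter> f e')"
      using card_Un_Int[OF fin] less.prems(4)[of e] less.prems(4)[of e'] E assms(2) by simp
    then obtain a where a: "a \<in> f e \<inter> f e'"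
      by (metis card.empty ex_in_conv not_numeral_le_zero)
    then obtain b where b: "b \<in> f e \<inter> f e'" "b \<noteq> a"
      using 2 card_mono[of "{a}" "f e \<inter> f e'"] by auto
    have "berge_path f b {e} {b, a} a"
      using a b berge_path.extend[OF berge_path.single, of e b a f] by simp
    then show ?thesis
      using a b E by (intro berge_cycleI[of f b "{e}" "{b, a}" a e']) auto
  next
    case False
    then obtain x where x: "x \<in> E" using less.prems(1) by (cases "E = {}") auto
    have n: "2 \<le> card (E - {x})" "card (E - {x}) < card E"
      using x finE False less.prems(1) by auto
    have "berge_cycle f (E - {x})"
      using n less.prems(2) by (intro less.hyps less.prems(3,4)) auto
    then obtain v e where "periodic_cycle f (card (E - {x})) v e" and e: "range e = E - {x}"
      using periodic_cycle_if_berge_cycle by metis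
    then interpret periodic_cycle f "card (E - {x})" v e by simp
    have "berge_cycle f (insert x (range e))"
      using less.prems(2) n(2) e x assms(1,2)
      by (intro extend_cycle[of V d] less.prems(3,4)) auto
    then show ?thesis using e x by (simp add: insert_absorb)
  qed
qed

section \<open>Partitions of the edge set and the decomposition theorem\<close>

lemma partition_with_cards:
  fixes c :: "nat \<Rightarrow> nat"
  assumes "finite E" "(\<Sum>i = 1..k. c i) = card E"
  shows "\<exists>P. disjoint_family_on P {1..k} \<and> (\<Union>i\<in>{1..k}. P i) = E \<and> (\<forall>i\<in>{1..k}. card (P i) = c i)"
  using assms
proof (induction k arbitrary: E)
  case 0
  then show ?case by (auto simp: disjoint_family_on_def)
next
  case (Suc k)
  then have "c (Suc k) \<le> card E" by simp
  then obtain T where T: "T \<subseteq> E" "card T = c (Suc k)"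
    by (metis obtain_subset_with_card_n)
  then have "card (E - T) = (\<Sum>i = 1..k. c i)"
    using Suc.prems by (simp add: card_Diff_subset finite_subset)
  then obtain P where P: "disjoint_family_on P {1..k}" "(\<Union>i\<in>{1..k}. P i) = E - T"
      "\<forall>i\<in>{1..k}. card (P i) = c i"
    using Suc.IH[of "E - T"] Suc.prems by auto
  let ?P = "P(Suc k := T)"
  have "(\<Union>i\<in>{1..Suc k}. ?P i) = E"
  proof -
    have "(\<Union>i\<in>{1..k}. ?P i) = (\<Union>i\<in>{1..k}. P i)" by auto
    moreover have "{1..Suc k} = insert (Suc k) {1..k}" by auto
    ultimately show ?thesis using P(2) T(1) by (metis UN_insert Un_Diff_cancel Un_absorb1 fun_upd_same)
  qed
  moreover have "disjoint_family_on ?P {1..Suc k}"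
    unfolding disjoint_family_on_def
  proof (intro ballI impI)
    fix i j assume ij: "i \<in> {1..Suc k}" "j \<in> {1..Suc k}" "i \<noteq> j"
    have PT: "P i \<inter> T = {}" if "i \<in> {1..k}" for i
      using P(2) that by blast
    consider "i = Suc k" "j \<in> {1..k}" | "j = Suc k" "i \<in> {1..k}" | "i \<in> {1..k}" "j \<in> {1..k}"
      using ij by force
    then show "?P i \<inter> ?P j = {}"
    proof cases
      case 3
      then show ?thesis using P(1) ij(3) by (simp add: disjoint_family_on_def)
    qed (use PT in \<open>auto simp: Int_commute\<close>)
  qed
  moreover have "\<forall>i\<in>{1..Suc k}. card (?P i) = c i"
    using P(3) T(2) by (auto simp: le_Suc_eq)
  ultimately show ?case by blast
qed

text \<open>Serves the necessity of the sum condition: each part contributes exactly its cycle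
  length to the number of edges.\<close>

lemma is_cycle_card:
  assumes "is_cycle H t"
  shows "card (edges H) = t"
proof -
  obtain e :: "nat \<Rightarrow> _" where "inj_on e {1..t}" "e ` {1..t} = edges H"
    using assms unfolding is_cycle_def by blast
  then show ?thesis using card_image[of e "{1..t}"] by simp
qed

theorem theorem2p2:
  fixes G :: "('v, 'e) pre_hypergraph"
    and k :: nat
    and c :: "nat \<Rightarrow> nat"
  assumes "hypergraph G"
    and "\<forall>i\<in>{1..k}. 2 \<le> c i \<and> c i \<le> card (verts G)"
    and "mono_on {1..k} c"
    and "corank G \<ge> enat (max (c k) (nat \<lceil>real (card (verts G)) / 2\<rceil> + 1))"
  shows "decomposes_into_cycles G k c \<longleftrightarrow> (\<Sum>i = 1..k. c i) = card (edges G)"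
proof
  interpret hypergraph G by fact
  assume "decomposes_into_cycles G k c"
  then obtain P where P: "disjoint_family_on P {1..k}" "(\<Union>i\<in>{1..k}. P i) = edges G"
      "\<forall>i\<in>{1..k}. is_cycle (G\<lparr>edges := P i\<rparr>) (c i)"
    unfolding decomposes_into_cycles_def by blast
  have "\<forall>i\<in>{1..k}. card (P i) = c i"
    using P(3) is_cycle_card by fastforce
  moreover have "card (edges G) = (\<Sum>i = 1..k. card (P i))"
    unfolding P(2)[symmetric] using P(1,2) finite_edges
    by (intro card_UN_disjoint) (auto simp: disjoint_family_on_def intro: finite_subset)
  ultimately show "(\<Sum>i = 1..k. c i) = card (edges G)" by simp
next
  interpret hypergraph G by fact
  assume "(\<Sum>i = 1..k. c i) = card (edges G)"
  from partition_with_cards[OF finite_edges this]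
  obtain P where P: "disjoint_family_on P {1..k}" "(\<Union>i\<in>{1..k}. P i) = edges G"
      "\<forall>i\<in>{1..k}. card (P i) = c i"
    by blast
  \<comment> \<open>The first argument of \<open>max\<close> ensures
    \<open>c i \<le> c k \<le> d\<close>, the second \<open>card (verts G) + 2 \<le> 2 * d\<close>,
    as \<open>jackson_berge_cycle\<close> demands.\<close>
  define d where "d = max (c k) (nat \<lceil>real (card (verts G)) / 2\<rceil> + 1)"
  have "card (verts G) + 2 \<le> 2 * d"
  proof -
    have "card (verts G) + 2 \<le> 2 * (nat \<lceil>real (card (verts G)) / 2\<rceil> + 1)"
    proof -
      have "real (card (verts G)) \<le> real (2 * nat \<lceil>real (card (verts G)) / 2\<rceil>)"
        using of_nat_ceiling[of "real (card (verts G)) / 2"]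
        unfolding of_nat_mult of_nat_numeral by linarith
      then show ?thesis unfolding of_nat_le_iff by simp
    qed
    then show ?thesis unfolding d_def by linarith
  qed
  have size: "d \<le> card (ends G x)" if "x \<in> edges G" for x
    using assms(4) that unfolding corank_def d_def by (simp add: le_INF_iff)
  have "is_cycle (G\<lparr>edges := P i\<rparr>) (c i)" if i: "i \<in> {1..k}" for i
  proof -
    have "c i \<le> c k" using assms(3) i by (auto simp: mono_on_def)
    then have "c i \<le> d" unfolding d_def by simp
    moreover have sub: "P i \<subseteq> edges G" using P(2) i by blast
    moreover have "ends G x \<subseteq> verts G" "d \<le> card (ends G x)" if "x \<in> P i" for x
      using that sub ends_subset size by blast+
    ultimately have "berge_cycle (ends G) (P i)"
      using P(3) i assms(2) \<open>card (verts G) + 2 \<le> 2 * d\<close> finite_verts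
      by (intro jackson_berge_cycle[of "verts G" d]) simp_all
    then have "is_cycle (G\<lparr>edges := P i\<rparr>) (card (P i))"
      using sub ends_subset by (intro is_cycle_if_berge_cycle[of "ends G"]) auto
    then show ?thesis using P(3) i by simp
  qed
  then show "decomposes_into_cycles G k c"
    unfolding decomposes_into_cycles_def using P by blast
qed

end
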